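(* Let $k\ge 2$ and $n\ge 0$ be integers and write $N=(2k-1)n+r$ with $0\le r\le 2k-2$. Then \[ \det_{0\leq i,j \leq N-1} \binom{2i+2j+3}{i+j+k+1} = \begin{cases} 2n+1, & \text{if } r=0,\\ (-1)^{\binom{k-1}{2}}(2n+1), & \text{if } r=k-1,\\ (-1)^{\binom{k}{2}}(4n+4), & \text{if } r=k,\\ (-1)^{k-1}(4n+4), & \text{if } r=2k-2,\\ 0, & \text{otherwise}. \end{cases} \] In addition, the $r=0$ case also holds when $k=1$; namely, for all integers $n\ge 0$, \[ \det_{0\leq i,j \leq n-1} \binom{2i+2j+3}{i+j+2} = 2n+1. \]
   Context: The notation $\det_{0\le i,j\le N-1}(a_{i,j})$ is the determinant of the $N\times N$ matrix $(a_{i,j})$; the empty determinant ($N=0$) is $1$. Binomial coefficients $\binom{a}{b}$ with $b>a\ge 0$ are $0$. *)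

theory Defs
  imports "Jordan_Normal_Form.Determinant"
begin

end

theory Submission
  imports Defs
begin

text \<open>
  The idea is to read the entries as coefficients of Laurent polynomials and to change the
  basis. For a formal variable \<open>y\<close> put \<open>c x = y powr x + y powr (-x)\<close>. Since
  \<open>c (1/2) ^ (2i+1) = (\<Sum>a\<le>i. ((2i+1) choose (i+a+1)) * c (a+1/2))\<close>, and since the entry
  \<open>(2i+2j+3) choose (i+j+k+1)\<close> is the coefficient of \<open>y powr (k-1/2)\<close> in
  \<open>c (1/2) ^ (2i+1) * c (1/2) ^ (2j+1) * c (1/2)\<close>, the Hankel matrix is \<open>P M P\<^sup>T\<close>, where
  \<open>P\<close> is unitriangular and \<open>M\<close> is the \<open>N \<times> N\<close> corner of the matrix of multiplication by
  \<open>c (1/2) * c (k-1/2)\<close> on the basis \<open>c (1/2), c (3/2), ...\<close> (\<open>hankel_entry\<close>): this basis is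
  orthonormal for half the constant term of a product, so the coefficient of \<open>y powr (k-1/2)\<close> in
  \<open>c (a+1/2) * c (b+1/2) * c (1/2)\<close> is that of \<open>c (a+1/2)\<close> in
  \<open>c (1/2) * c (k-1/2) * c (b+1/2)\<close>.

  Multiplication by \<open>c (1/2)\<close> sends \<open>c (b+1/2)\<close> to \<open>c b + c (b+1)\<close>; multiplication by
  \<open>c (k-1/2)\<close> sends \<open>c b\<close> to \<open>c (b+k-1/2) + c (b-k+1/2)\<close>, and the matrix \<open>R\<close> of the latter
  has essentially two entries in each row. Splitting off the bidiagonal first factor replaces
  \<open>det M\<close> by the determinant of \<open>R\<close> (\<open>N\<close> rows, \<open>N+1\<close> columns) bordered on top by the row
  \<open>(-1)^b\<close>, which that factor annihilates (\<open>fdet_bordered\<close>).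

  In the bordered matrix the last \<open>2k-1\<close> rows and columns can be eliminated, because those rows
  are almost permutation rows; what is left is again a bordered matrix of the same kind, of size
  smaller by \<open>2k-1\<close>, and only its border has changed (\<open>fdet_bordered_step\<close>). A single
  integer \<open>m\<close> describes the border, and one elimination turns \<open>m\<close> into \<open>m+1\<close>
  (\<open>fdet_border_weight_step\<close>). This is where the linear growth in \<open>n\<close> comes from: after \<open>n\<close>
  eliminations a matrix of size \<open>r+1\<close> remains whose border is affine in \<open>n\<close>. For
  \<open>0 \<le> r \<le> 2k-2\<close> this matrix is so sparse that its determinant can be read off.
\<close>

section \<open>Determinants of matrices given by their entry functions\<close>

text \<open>
  Entry functions on all of \<open>nat \<times> nat\<close> allow submatrices to be described by shifting indices,
  without carrying the dimensions along.
\<close>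

definition fdet :: "nat \<Rightarrow> (nat \<Rightarrow> nat \<Rightarrow> int) \<Rightarrow> int" where
  "fdet n f = det (mat n n (\<lambda>(i, j). f i j))"

lemma fdet_cong:
  assumes "\<And>i j. i < n \<Longrightarrow> j < n \<Longrightarrow> f i j = g i j"
  shows "fdet n f = fdet n g"
  unfolding fdet_def by (rule arg_cong[where f = det], rule eq_matI) (use assms in auto)

lemma fdet_mult:
  "fdet n (\<lambda>i j. \<Sum>l<n. f i l * g l j) = fdet n f * fdet n g"
proof -
  have "mat n n (\<lambda>(i, j). \<Sum>l<n. f i l * g l j) =
        mat n n (\<lambda>(i, j). f i j) * mat n n (\<lambda>(i, j). g i j)"
    by (rule eq_matI) (auto simp: scalar_prod_def lessThan_atLeast0)
  thus ?thesis
    unfolding fdet_def by (simp add: det_mult[of _ n])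
qed

lemma fdet_upper_triangular:
  assumes "\<And>i j. j < i \<Longrightarrow> i < n \<Longrightarrow> f i j = 0"
  shows "fdet n f = (\<Prod>i<n. f i i)"
proof -
  have "fdet n f = prod_list (diag_mat (mat n n (\<lambda>(i, j). f i j)))"
    unfolding fdet_def by (rule det_upper_triangular[of _ n]) (use assms in auto)
  thus ?thesis
    by (simp add: prod_list_diag_prod lessThan_atLeast0)
qed

lemma fdet_lower_triangular:
  assumes "\<And>i j. i < j \<Longrightarrow> j < n \<Longrightarrow> f i j = 0"
  shows "fdet n f = (\<Prod>i<n. f i i)"
proof -
  have "fdet n f = prod_list (diag_mat (mat n n (\<lambda>(i, j). f i j)))"
    unfolding fdet_def by (rule det_lower_triangular[of n]) (use assms in auto)
  thus ?thesis
    by (simp add: prod_list_diag_prod lessThan_atLeast0)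
qed

lemma fdet_transpose: "fdet n (\<lambda>i j. f j i) = fdet n f"
proof -
  have "mat n n (\<lambda>(i, j). f j i) = (mat n n (\<lambda>(i, j). f i j))\<^sup>T"
    by (rule eq_matI) auto
  thus ?thesis
    unfolding fdet_def by (simp add: det_transpose[of _ n])
qed

lemma fdet_block_upper:
  assumes "\<And>i j. a \<le> i \<Longrightarrow> i < a + b \<Longrightarrow> j < a \<Longrightarrow> f i j = 0"
  shows "fdet (a + b) f = fdet a f * fdet b (\<lambda>i j. f (a + i) (a + j))"
proof -
  have "mat (a + b) (a + b) (\<lambda>(i, j). f i j) =
        four_block_mat (mat a a (\<lambda>(i, j). f i j)) (mat a b (\<lambda>(i, j). f i (a + j)))
          (0\<^sub>m b a) (mat b b (\<lambda>(i, j). f (a + i) (a + j)))"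
    by (rule eq_matI) (use assms in auto)
  thus ?thesis
    unfolding fdet_def by (simp add: det_four_block_mat_lower_left_zero[of _ a _ b])
qed

text \<open>
  Moving the first \<open>b\<close> columns past the last \<open>a\<close> ones costs \<open>a * b\<close> transpositions and makes the
  matrix block upper triangular. All permutation signs below come
  from here.
\<close>

lemma fdet_block_antidiagonal:
  assumes "\<And>i j. a \<le> i \<Longrightarrow> i < a + b \<Longrightarrow> b \<le> j \<Longrightarrow> j < a + b \<Longrightarrow> f i j = 0"
  shows "fdet (a + b) f =
         (- 1) ^ (a * b) * (fdet a (\<lambda>i j. f i (b + j)) * fdet b (\<lambda>i j. f (a + i) j))"
proof -
  have "fdet (a + b) f = (- 1) ^ (b * a) *
      fdet (a + b) (\<lambda>i j. f i (if j < a then b + j else j - a))"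
    unfolding fdet_def
    by (subst det_swap_initial_cols[of _ "a + b" b a])
       (auto intro!: arg_cong[where f = det] eq_matI simp: ac_simps)
  also have "fdet (a + b) (\<lambda>i j. f i (if j < a then b + j else j - a)) =
      fdet a (\<lambda>i j. f i (if j < a then b + j else j - a)) *
      fdet b (\<lambda>i j. f (a + i) (if a + j < a then b + (a + j) else a + j - a))"
    by (rule fdet_block_upper) (use assms in auto)
  also have "fdet a (\<lambda>i j. f i (if j < a then b + j else j - a)) = fdet a (\<lambda>i j. f i (b + j))"
    by (rule fdet_cong) auto
  finally show ?thesis by (simp add: mult.commute)
qed

lemma fdet_1: "fdet (Suc 0) f = f 0 0"
  by (simp add: fdet_upper_triangular)

lemma fdet_2: "fdet 2 f = f 0 0 * f 1 1 - f 0 1 * f 1 0"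
proof -
  let ?A = "mat 2 2 (\<lambda>(i, j). f i j)"
  have "det ?A = (\<Sum>j<2. ?A $$ (0, j) * cofactor ?A 0 j)"
    by (rule laplace_expansion_row) auto
  thus ?thesis
    by (simp add: fdet_def numeral_2_eq_2 cofactor_def det_single mat_delete_def)
qed

lemma fdet_antitriangular:
  assumes "\<And>i j. i < n \<Longrightarrow> j < n \<Longrightarrow> n \<le> i + j \<Longrightarrow> f i j = 0"
  shows "fdet n f = (- 1) ^ (n choose 2) * (\<Prod>i<n. f i (n - 1 - i))"
  using assms
proof (induction n arbitrary: f)
  case 0
  show ?case by (simp add: fdet_upper_triangular numeral_2_eq_2)
next
  case (Suc n)
  have "fdet (n + 1) f =
      (- 1) ^ (n * 1) * (fdet n (\<lambda>i j. f i (1 + j)) * fdet 1 (\<lambda>i j. f (n + i) j))"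
    by (rule fdet_block_antidiagonal) (use Suc.prems in auto)
  moreover have "fdet n (\<lambda>i j. f i (1 + j)) =
      (- 1) ^ (n choose 2) * (\<Prod>i<n. f i (1 + (n - 1 - i)))"
    by (rule Suc.IH) (use Suc.prems in auto)
  moreover have "(\<Prod>i<n. f i (1 + (n - 1 - i))) = (\<Prod>i<n. f i (n - i))"
    by (rule prod.cong) (auto intro!: arg_cong[where f = "f _"])
  moreover have "Suc n choose 2 = n + (n choose 2)"
    by (simp add: numeral_2_eq_2)
  ultimately show ?case
    by (simp add: fdet_1 power_add)
qed

section \<open>Folding the Hankel matrix\<close>

text \<open>
  With \<open>c x = y powr x + y powr (-x)\<close>, this is the coefficient of \<open>c (i+1/2)\<close> in
  \<open>c (k-1/2) * c b = c (b+k-1/2) + c (b-k+1/2)\<close>; the last two summands are the two signs of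
  \<open>b-k+1/2\<close>. They coincide for \<open>i = k-1\<close> and \<open>b = 0\<close>, where the value is \<open>2\<close>, in accordance
  with \<open>c 0 = 2\<close>.
\<close>

definition fold_coeff :: "nat \<Rightarrow> nat \<Rightarrow> nat \<Rightarrow> int" where
  "fold_coeff k i b = of_bool (b = i + k) + of_bool (b + k = i + 1) + of_bool (b + i + 1 = k)"

lemma coeff_one_plus_x_power: "coeff ([:1, 1:] ^ n) m = int (n choose m)"
proof (cases "m \<le> n")
  case False
  have "degree ([:1, 1 :: int:] ^ n) \<le> n"
    using degree_power_le[of "[:1, 1 :: int:]" n] by simp
  thus ?thesis
    using False by (simp add: coeff_eq_0 del: power_Suc)
qed (simp add: coeff_linear_poly_power)

text \<open>
  Binomial symmetry pairs the powers \<open>i - a\<close> and \<open>i + a + 1\<close> of the indeterminate. The summand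
  for \<open>a\<close> is \<open>c (a+1/2)\<close>, multiplied by a fractional power that makes it a polynomial.
\<close>

lemma odd_power_fold:
  "[:1, 1:] ^ (2 * i + 1) =
     (\<Sum>a\<le>i. smult (int ((2 * i + 1) choose (i + a + 1))) (monom 1 (i - a) + monom 1 (i + a + 1)))"
proof (rule poly_eqI)
  fix m
  let ?c = "\<lambda>a. int ((2 * i + 1) choose (i + a + 1))"
  have "coeff (\<Sum>a\<le>i. smult (?c a) (monom 1 (i - a) + monom 1 (i + a + 1))) m =
        (\<Sum>a\<le>i. (if i - a = m then ?c a else 0) + (if i + a + 1 = m then ?c a else 0))"
    by (auto simp: coeff_sum intro!: sum.cong)
  also have "\<dots> = (\<Sum>a\<le>i. if i - a = m then ?c a else 0) + (\<Sum>a\<le>i. if i + a + 1 = m then ?c a else 0)"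
    by (rule sum.distrib)
  also have "(\<Sum>a\<le>i. if i - a = m then ?c a else 0) =
             (\<Sum>a\<le>i. if a = i - m then (if m \<le> i then ?c (i - m) else 0) else 0)"
    by (rule sum.cong) auto
  also have "\<dots> = (if m \<le> i then int ((2 * i + 1) choose m) else 0)"
    using binomial_symmetric[of m "2 * i + 1"]
    by (auto simp: mult_2 Suc_diff_le simp del: binomial_Suc_Suc)
  also have "(\<Sum>a\<le>i. if i + a + 1 = m then ?c a else 0) =
             (\<Sum>a\<le>i. if a = m - i - 1 then (if i < m then int ((2 * i + 1) choose m) else 0) else 0)"
    by (rule sum.cong) auto
  also have "\<dots> = (if i < m then int ((2 * i + 1) choose m) else 0)"
    by auto
  also have "(if m \<le> i then int ((2 * i + 1) choose m) else 0) +
      (if i < m then int ((2 * i + 1) choose m) else 0) = int ((2 * i + 1) choose m)"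
    by auto
  finally show "coeff ([:1, 1:] ^ (2 * i + 1)) m =
      coeff (\<Sum>a\<le>i. smult (?c a) (monom 1 (i - a) + monom 1 (i + a + 1))) m"
    by (simp only: coeff_one_plus_x_power)
qed

text \<open>
  The entry is a coefficient of \<open>(1+y) ^ (2i+1) * (1+y) ^ (2j+1) * (1+y)\<close>; folding the two odd
  powers expresses it by the coefficients belonging to the products of two basis elements. Summing
  over all indices below \<open>N\<close> is harmless, as the binomials vanish outside the triangles, and
  gives the formula the shape of a product of three \<open>N \<times> N\<close> matrices.
\<close>

lemma hankel_entry:
  assumes "k \<ge> 1" "i < N" "j < N"
  shows "int ((2 * i + 2 * j + 3) choose (i + j + k + 1)) =
    (\<Sum>b<N. (\<Sum>a<N. int ((2 * i + 1) choose (i + a + 1)) * (fold_coeff k a b + fold_coeff k a (b + 1)))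
        * int ((2 * j + 1) choose (j + b + 1)))"
proof -
  let ?c = "\<lambda>i a. int ((2 * i + 1) choose (i + a + 1))"
  let ?t = "\<lambda>i a. monom 1 (i - a) + monom 1 (i + a + 1) :: int poly"
  let ?M = "\<lambda>a b. fold_coeff k a b + fold_coeff k a (b + 1)"
  have entry: "coeff (?t i a * ?t j b * (monom 1 0 + monom 1 1)) (i + j + k + 1) = ?M a b"
    if "a \<le> i" "b \<le> j" for a b
  proof -
    let ?s = "i + j + k + 1"
    \<comment> \<open>The product has eight monomials. Two of them have too small a degree to contribute,
      and the other six match the six summands of the two fold coefficients.\<close>
    have "i - a + (j - b) + 0 \<noteq> ?s" "i - a + (j - b) + 1 \<noteq> ?s"
      "i - a + (j + b + 1) + 0 = ?s \<longleftrightarrow> b = a + k"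
      "i - a + (j + b + 1) + 1 = ?s \<longleftrightarrow> b + 1 = a + k"
      "i + a + 1 + (j - b) + 0 = ?s \<longleftrightarrow> b + 1 + k = a + 1"
      "i + a + 1 + (j - b) + 1 = ?s \<longleftrightarrow> b + k = a + 1"
      "i + a + 1 + (j + b + 1) + 0 = ?s \<longleftrightarrow> b + a + 1 = k"
      "i + a + 1 + (j + b + 1) + 1 = ?s \<longleftrightarrow> b + 1 + a + 1 = k"
      using that assms(1) by arith+
    thus ?thesis
      by (simp only: ring_distribs mult_monom mult_1 coeff_add coeff_monom fold_coeff_def of_bool_def
          if_False add_0_left add_0_right ac_simps)
  qed
  have "p ^ (2 * i + 2 * j + 3) = p ^ (2 * i + 1) * p ^ (2 * j + 1) * p" for p :: "int poly"
    by (simp add: power_add power3_eq_cube mult_ac)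
  moreover have x: "monom 1 0 + monom 1 1 = ([:1, 1:] :: int poly)"
    by (simp add: monom_altdef)
  ultimately have "[:1, 1:] ^ (2 * i + 2 * j + 3) =
      [:1, 1:] ^ (2 * i + 1) * [:1, 1:] ^ (2 * j + 1) * (monom 1 0 + monom 1 1 :: int poly)"
    by (simp only: x)
  also have "\<dots> = (\<Sum>a\<le>i. smult (?c i a) (?t i a)) * (\<Sum>b\<le>j. smult (?c j b) (?t j b)) * (monom 1 0 + monom 1 1)"
    unfolding odd_power_fold ..
  also have "\<dots> = (\<Sum>a\<le>i. \<Sum>b\<le>j. smult (?c i a * ?c j b) (?t i a * ?t j b * (monom 1 0 + monom 1 1)))"
    by (subst sum_product) (simp only: sum_distrib_right sum_distrib_left
        mult_smult_left mult_smult_right smult_smult mult.commute)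
  finally have "coeff ([:1, 1:] ^ (2 * i + 2 * j + 3)) (i + j + k + 1) =
      (\<Sum>a\<le>i. \<Sum>b\<le>j. ?c i a * ?c j b * ?M a b)"
    by (simp only: coeff_sum coeff_smult) (auto intro!: sum.cong simp only: entry atMost_iff)
  hence "int ((2 * i + 2 * j + 3) choose (i + j + k + 1)) = (\<Sum>a\<le>i. \<Sum>b\<le>j. ?c i a * ?c j b * ?M a b)"
    by (simp only: coeff_one_plus_x_power)
  also have "\<dots> = (\<Sum>a<N. \<Sum>b\<le>j. ?c i a * ?c j b * ?M a b)"
    by (rule sum.mono_neutral_left, simp, use assms in force, intro ballI)
      (simp add: binomial_eq_0 del: binomial_Suc_Suc)
  also have "\<dots> = (\<Sum>a<N. \<Sum>b<N. ?c i a * ?c j b * ?M a b)"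
    by (rule sum.cong[OF refl], rule sum.mono_neutral_left, simp, use assms in force, intro ballI)
      (simp add: binomial_eq_0 del: binomial_Suc_Suc)
  also have "\<dots> = (\<Sum>b<N. \<Sum>a<N. ?c i a * ?c j b * ?M a b)"
    by (rule sum.swap)
  finally show ?thesis
    by (simp only: sum_distrib_right sum_distrib_left mult_ac)
qed

lemma fdet_hankel:
  assumes "k \<ge> 1"
  shows "fdet N (\<lambda>i j. int ((2 * i + 2 * j + 3) choose (i + j + k + 1))) =
         fdet N (\<lambda>a b. fold_coeff k a b + fold_coeff k a (b + 1))"
proof -
  let ?c = "\<lambda>i a. int ((2 * i + 1) choose (i + a + 1))"
  have "fdet N (\<lambda>i j. int ((2 * i + 2 * j + 3) choose (i + j + k + 1))) =
      fdet N ?c * fdet N (\<lambda>a b. fold_coeff k a b + fold_coeff k a (b + 1)) * fdet N (\<lambda>b j. ?c j b)"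
    unfolding fdet_mult[symmetric] by (rule fdet_cong, rule hankel_entry) (use assms in auto)
  moreover have "fdet N ?c = 1"
    by (subst fdet_lower_triangular) (auto simp: mult_2 simp del: binomial_Suc_Suc)
  moreover have "fdet N (\<lambda>b j. ?c j b) = 1"
    by (subst fdet_upper_triangular) (auto simp: mult_2 simp del: binomial_Suc_Suc)
  ultimately show ?thesis by simp
qed

section \<open>Bordering\<close>

definition bordered :: "nat \<Rightarrow> (nat \<Rightarrow> int) \<Rightarrow> nat \<Rightarrow> nat \<Rightarrow> int" where
  "bordered k v i j = (if i = 0 then v j else fold_coeff k (i - 1) j)"

text \<open>
  The matrix on the left is \<open>R B\<close>, where \<open>R\<close> has \<open>N+1\<close> columns and the column \<open>b\<close> of the
  bidiagonal \<open>B\<close> is \<open>e b + e (b+1)\<close>. Prepending the column \<open>e 0\<close> to \<open>B\<close> makes it square and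
  unitriangular, and the alternating row is orthogonal to all columns of \<open>B\<close>. So the product of the
  two enlarged matrices has the first row \<open>(1, 0, ..., 0)\<close> and \<open>R B\<close> as its complementary block.
\<close>

lemma fdet_bordered:
  "fdet N (\<lambda>a b. fold_coeff k a b + fold_coeff k a (b + 1)) =
   fdet (Suc N) (bordered k (\<lambda>c. (- 1) ^ c))"
proof -
  let ?S = "bordered k (\<lambda>c. (- 1) ^ c)"
  let ?B = "\<lambda>b j :: nat. of_bool (b = j) + of_bool (Suc b = j) :: int"
  let ?G = "\<lambda>i j. ?S i j + (if j = 0 then 0 else ?S i (j - 1))"
  have "fdet (Suc N) ?S = fdet (Suc N) ?S * fdet (Suc N) ?B"
    by (simp add: fdet_upper_triangular)
  also have "\<dots> = fdet (Suc N) ?G"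
    unfolding fdet_mult[symmetric]
  proof (rule fdet_cong)
    fix i j assume "i < Suc N" "j < Suc N"
    have "(\<Sum>l<Suc N. ?S i l * ?B l j) =
          (\<Sum>l<Suc N. if l = j then ?S i j else 0) +
          (\<Sum>l<Suc N. if l = j - 1 then (if j = 0 then 0 else ?S i (j - 1)) else 0)"
      unfolding sum.distrib[symmetric] by (rule sum.cong) (auto simp: of_bool_def)
    also have "\<dots> = ?G i j"
      using \<open>j < Suc N\<close> by (cases j) (simp_all del: sum.lessThan_Suc)
    finally show "(\<Sum>l<Suc N. ?S i l * ?B l j) = ?G i j" .
  qed
  also have "\<dots> = fdet (1 + N) (\<lambda>i j. ?G j i)"
    unfolding plus_1_eq_Suc by (rule fdet_transpose[symmetric])
  also have "\<dots> = fdet 1 (\<lambda>i j. ?G j i) * fdet N (\<lambda>i j. ?G (1 + j) (1 + i))"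
  proof (rule fdet_block_upper)
    fix i j :: nat assume "1 \<le> i" "j < 1"
    thus "?G j i = 0"
      by (cases i) (auto simp: bordered_def)
  qed
  also have "fdet N (\<lambda>i j. ?G (1 + j) (1 + i)) = fdet N (\<lambda>i j. ?G (1 + i) (1 + j))"
    by (rule fdet_transpose)
  also have "\<dots> = fdet N (\<lambda>a b. fold_coeff k a b + fold_coeff k a (b + 1))"
    by (rule fdet_cong) (simp add: bordered_def)
  also have "fdet 1 (\<lambda>i j. ?G j i) = 1"
    by (simp add: fdet_1 bordered_def)
  finally show ?thesis
    by simp
qed

section \<open>Eliminating a period\<close>

text \<open>
  Call the row of \<open>fold_coeff k\<close> with index \<open>p\<close>, which is the row \<open>p + 1\<close> of the bordered
  matrix, the fold row \<open>p\<close>. In the last \<open>k\<close> columns it has only the entry \<open>1\<close> at column \<open>p + k\<close>. These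
  entries serve as pivots for the fold rows \<open>N, ..., N+k-1\<close>: column operations clear those rows in
  the first \<open>N+k\<close> columns, leave the other fold rows alone, and subtract the stated sum from the
  border. The fold rows \<open>N+k, ..., N+2k-2\<close> have only the entry \<open>1\<close> at column \<open>p - k + 1\<close>. So the
  last \<open>2k-1\<close> rows now vanish in the first \<open>N+1\<close> columns and form a cyclic shift in
  the others, which is an even permutation because its sign is \<open>(-1) ^ (k * (k-1))\<close>.
\<close>

lemma fdet_bordered_step:
  assumes "k \<ge> 1"
  shows "fdet (N + 2 * k) (bordered k v) =
         fdet (N + 1) (bordered k (\<lambda>c. v c - (\<Sum>b=N + k..<N + 2 * k. v b * fold_coeff k (b - k) c)))"
proof -
  let ?w = "\<lambda>c. v c - (\<Sum>b=N + k..<N + 2 * k. v b * fold_coeff k (b - k) c)"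
  let ?e = "\<lambda>l c. if N + k \<le> l \<and> c < N + k then fold_coeff k (l - k) c else 0"
  let ?E = "\<lambda>l c. of_bool (l = c) - ?e l c"
  define G where "G i c = bordered k v i c -
    (if c < N + k then \<Sum>b=N + k..<N + 2 * k. bordered k v i b * fold_coeff k (b - k) c else 0)" for i c
  have "fdet (N + 2 * k) ?E = (\<Prod>c<N + 2 * k. ?E c c)"
    by (rule fdet_lower_triangular) auto
  also have "\<dots> = 1"
    by (rule prod.neutral) auto
  finally have "fdet (N + 2 * k) (bordered k v) = fdet (N + 2 * k) (bordered k v) * fdet (N + 2 * k) ?E"
    by simp
  also have "\<dots> = fdet (N + 2 * k) G"
    unfolding fdet_mult[symmetric]
  proof (rule fdet_cong)
    fix i c assume "i < N + 2 * k" and c: "c < N + 2 * k"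
    have "(\<Sum>l<N + 2 * k. bordered k v i l * ?E l c) =
      (\<Sum>l<N + 2 * k. if l = c then bordered k v i c else 0) -
      (\<Sum>l<N + 2 * k. bordered k v i l * ?e l c)"
      unfolding sum_subtractf[symmetric] by (rule sum.cong) (auto simp: algebra_simps)
    also have "(\<Sum>l<N + 2 * k. bordered k v i l * ?e l c) =
      (\<Sum>l=N + k..<N + 2 * k. bordered k v i l * ?e l c)"
      by (rule sum.mono_neutral_right) auto
    also have "\<dots> = (if c < N + k then \<Sum>b=N + k..<N + 2 * k. bordered k v i b * fold_coeff k (b - k) c else 0)"
      by auto
    finally show "(\<Sum>l<N + 2 * k. bordered k v i l * ?E l c) = G i c"
      using c by (simp add: G_def)
  qed
  finally have column_ops: "fdet (N + 2 * k) (bordered k v) = fdet (N + 2 * k) G" .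
  have size: "N + 2 * k = (N + 1) + (2 * k - 1)"
    using assms by simp
  have G_row: "G (Suc p) c =
      (if N \<le> p \<and> p < N + k \<and> c < N + k then 0 else fold_coeff k p c)" if "p < N + 2 * k - 1" for p c
  proof -
    have "(\<Sum>b=N + k..<N + 2 * k. bordered k v (Suc p) b * fold_coeff k (b - k) c) =
          (\<Sum>b=N + k..<N + 2 * k. if b = p + k then fold_coeff k p c else 0)"
      using that by (intro sum.cong) (auto simp: bordered_def fold_coeff_def[of k p "_ :: nat"])
    thus ?thesis
      by (auto simp: G_def bordered_def)
  qed
  have "fdet ((N + 1) + (2 * k - 1)) G =
      fdet (N + 1) G * fdet (2 * k - 1) (\<lambda>i j. G (N + 1 + i) (N + 1 + j))"
  proof (rule fdet_block_upper)
    fix i j assume "N + 1 \<le> i" "i < N + 1 + (2 * k - 1)" "j < N + 1"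
    thus "G i j = 0"
      using G_row[of "i - 1" j] assms by (auto simp: fold_coeff_def)
  qed
  also have "fdet (N + 1) G = fdet (N + 1) (bordered k ?w)"
  proof (rule fdet_cong)
    fix i j assume "i < N + 1" "j < N + 1"
    thus "G i j = bordered k ?w i j"
      using G_row[of "i - 1" j] assms by (cases i) (auto simp: G_def bordered_def)
  qed
  also have "fdet (2 * k - 1) (\<lambda>i j. G (N + 1 + i) (N + 1 + j)) = 1"
  proof -
    have row: "G (N + 1 + i) (N + 1 + j) =
       (if i < k then of_bool (j + 1 = i + k) else of_bool (j + k = i))"
      if "i < 2 * k - 1" "j < 2 * k - 1" for i j
      using that G_row[of "N + i" "N + 1 + j"] by (auto simp: fold_coeff_def)
    have "2 * k - 1 = k + (k - 1)"
      using assms by simp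
    have "fdet (k + (k - 1)) (\<lambda>i j. G (N + 1 + i) (N + 1 + j)) = (- 1) ^ (k * (k - 1)) *
      (fdet k (\<lambda>i j. G (N + 1 + i) (N + 1 + (k - 1 + j))) *
       fdet (k - 1) (\<lambda>i j. G (N + 1 + (k + i)) (N + 1 + j)))"
      by (rule fdet_block_antidiagonal) (subst row, auto)
    also have "fdet k (\<lambda>i j. G (N + 1 + i) (N + 1 + (k - 1 + j))) = fdet k (\<lambda>i j. of_bool (i = j))"
      by (rule fdet_cong, subst row) (use assms in auto)
    also have "fdet (k - 1) (\<lambda>i j. G (N + 1 + (k + i)) (N + 1 + j)) = fdet (k - 1) (\<lambda>i j. of_bool (i = j))"
      by (rule fdet_cong, subst row) auto
    finally have "fdet (k + (k - 1)) (\<lambda>i j. G (N + 1 + i) (N + 1 + j)) = (- 1) ^ (k * (k - 1))"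
      by (simp add: fdet_upper_triangular)
    moreover have "even (k * (k - 1))"
      by (cases k) auto
    ultimately show ?thesis
      unfolding \<open>2 * k - 1 = k + (k - 1)\<close> by simp
  qed
  finally show ?thesis
    by (simp only: column_ops size[symmetric] mult_1_right)
qed

text \<open>
  Up to the alternating sign, the weight is \<open>1 + m * t\<close>, where \<open>t\<close> counts the indices \<open>i\<close> among
  \<open>N, ..., N+k-1\<close> with \<open>i - k + 1 = c\<close> and those with \<open>i - k + 1 = -c\<close>, for \<open>c \<le> N\<close>. These are
  the pivot rows of an elimination that meet column \<open>c\<close>.
\<close>

definition border_weight :: "nat \<Rightarrow> nat \<Rightarrow> nat \<Rightarrow> nat \<Rightarrow> int" where
  "border_weight k N m c = (- 1) ^ c * (1 + int m * (of_bool (N < c + k) + of_bool (N + c < k)))"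

text \<open>
  On the last \<open>k\<close> columns of the large border the weight is \<open>(-1) ^ b * (1 + m)\<close>. A row meeting both
  the pivot column \<open>b\<close> and the column \<open>c\<close> forces \<open>b\<close> and \<open>c\<close> to have opposite parities, since the
  step length \<open>2k-1\<close> is odd. Hence the subtracted terms reinforce \<open>(-1) ^ c\<close> instead of
  cancelling it, and \<open>1\<close> becomes \<open>1 + (1 + m) * t\<close>.
\<close>

lemma fdet_border_weight_step:
  assumes "k \<ge> 1"
  shows "fdet (N + 2 * k) (bordered k (border_weight k (N + 2 * k - 1) m)) =
         fdet (N + 1) (bordered k (border_weight k N (m + 1)))"
  unfolding fdet_bordered_step[OF assms]
proof (rule fdet_cong)
  fix i c assume "i < N + 1" and c: "c < N + 1"
  let ?v = "border_weight k (N + 2 * k - 1) m"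
  have "(\<Sum>b=N + k..<N + 2 * k. ?v b * fold_coeff k (b - k) c) =
        (\<Sum>b=N + k..<N + 2 * k.
          (if b = c + 2 * k - 1 then - ((- 1) ^ c * (1 + int m)) else 0) +
          (if b = 2 * k - 1 - c then (if N + c < k then - ((- 1) ^ c * (1 + int m)) else 0) else 0))"
  proof (rule sum.cong[OF refl])
    fix b assume b: "b \<in> {N + k..<N + 2 * k}"
    hence v: "?v b = (- 1) ^ b * (1 + int m)"
      using assms by (auto simp: border_weight_def)
    have sgn1: "(- 1 :: int) ^ b = - ((- 1) ^ c)" if "b = c + 2 * k - 1"
    proof -
      have "even b \<longleftrightarrow> odd c" using that assms by presburger
      thus ?thesis by (auto simp: minus_one_power_iff)
    qed
    have sgn2: "(- 1 :: int) ^ b = - ((- 1) ^ c)" if "b + c + 1 = 2 * k"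
    proof -
      have "even b \<longleftrightarrow> odd c" using that assms by presburger
      thus ?thesis by (auto simp: minus_one_power_iff)
    qed
    have "fold_coeff k (b - k) c = of_bool (b = c + 2 * k - 1) + of_bool (b + c + 1 = 2 * k)"
      using b c assms by (auto simp: fold_coeff_def of_bool_def)
    thus "?v b * fold_coeff k (b - k) c =
        (if b = c + 2 * k - 1 then - ((- 1) ^ c * (1 + int m)) else 0) +
        (if b = 2 * k - 1 - c then (if N + c < k then - ((- 1) ^ c * (1 + int m)) else 0) else 0)"
      using b c assms sgn1 sgn2 unfolding v by auto
  qed
  also have "\<dots> = - ((- 1) ^ c * (1 + int m) * (of_bool (N < c + k) + of_bool (N + c < k)))"
    unfolding sum.distrib using c assms by auto
  finally have "?v c - (\<Sum>b=N + k..<N + 2 * k. ?v b * fold_coeff k (b - k) c) = border_weight k N (m + 1) c"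
    using c assms by (auto simp: border_weight_def algebra_simps)
  thus "bordered k (\<lambda>c. ?v c - (\<Sum>b=N + k..<N + 2 * k. ?v b * fold_coeff k (b - k) c)) i c =
        bordered k (border_weight k N (m + 1)) i c"
    by (simp add: bordered_def)
qed

lemma fdet_border_weight_reduce:
  assumes "k \<ge> 1"
  shows "fdet ((2 * k - 1) * n + r + 1) (bordered k (border_weight k ((2 * k - 1) * n + r) m)) =
         fdet (r + 1) (bordered k (border_weight k r (m + n)))"
proof (induction n arbitrary: m)
  case (Suc n)
  let ?N = "(2 * k - 1) * n + r"
  have *: "(2 * k - 1) * Suc n + r + 1 = ?N + 2 * k" "(2 * k - 1) * Suc n + r = ?N + 2 * k - 1"
    using assms by (cases k; simp add: algebra_simps)+
  show ?case
    by (subst *(1), subst *(2), subst fdet_border_weight_step[OF assms], subst Suc.IH) simp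
qed simp

lemma fdet_hankel_reduce:
  assumes "k \<ge> 1"
  shows "fdet ((2 * k - 1) * n + r) (\<lambda>i j. int ((2 * i + 2 * j + 3) choose (i + j + k + 1))) =
         fdet (r + 1) (bordered k (border_weight k r n))"
proof -
  have "(\<lambda>c. (- 1) ^ c) = border_weight k ((2 * k - 1) * n + r) 0"
    by (auto simp: border_weight_def)
  thus ?thesis
    using fdet_border_weight_reduce[OF assms, of n r 0]
    unfolding fdet_hankel[OF assms] fdet_bordered by simp
qed

section \<open>The remaining small matrices\<close>

lemma fdet_bordered_remainder_0:
  assumes "k \<ge> 1"
  shows "fdet (0 + 1) (bordered k (border_weight k 0 n)) = 2 * int n + 1"
  using assms by (simp add: fdet_1 bordered_def border_weight_def)

text \<open>
  The fold rows \<open>i < k - 1\<close> meet only the columns \<open>k - 1 - i > 0\<close>, so column \<open>0\<close> is nonzero only in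
  the border and the fold rows form an antidiagonal matrix.
\<close>

lemma fdet_bordered_remainder_k_minus_1:
  assumes "k \<ge> 2"
  shows "fdet (k - 1 + 1) (bordered k (border_weight k (k - 1) n)) =
         (- 1) ^ ((k - 1) choose 2) * (2 * int n + 1)"
proof -
  let ?f = "bordered k (border_weight k (k - 1) n)"
  have "fdet (1 + (k - 1)) ?f = fdet 1 ?f * fdet (k - 1) (\<lambda>i j. ?f (1 + i) (1 + j))"
    by (rule fdet_block_upper) (auto simp: bordered_def fold_coeff_def)
  also have "fdet (k - 1) (\<lambda>i j. ?f (1 + i) (1 + j)) = (- 1) ^ ((k - 1) choose 2) *
      (\<Prod>i<k - 1. ?f (1 + i) (1 + (k - 1 - 1 - i)))"
    by (rule fdet_antitriangular) (auto simp: bordered_def fold_coeff_def)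
  also have "(\<Prod>i<k - 1. ?f (1 + i) (1 + (k - 1 - 1 - i))) = 1"
    by (rule prod.neutral) (auto simp: bordered_def fold_coeff_def)
  also have "fdet 1 ?f = 2 * int n + 1"
    using assms by (simp add: fdet_1 bordered_def border_weight_def)
  finally show ?thesis
    by (simp add: mult.commute)
qed

text \<open>
  Only the border and the fold row \<open>0\<close> reach the columns \<open>k - 1\<close> and \<open>k\<close>. They form a block of
  determinant \<open>v (k-1) - v k\<close>, where the border \<open>v\<close> alternates in sign; this doubles \<open>n + 1\<close>.
  The other rows are antidiagonal, with the entry \<open>2\<close> at the end.
\<close>

lemma fdet_bordered_remainder_k:
  assumes "k \<ge> 2"
  shows "fdet (k + 1) (bordered k (border_weight k k n)) = (- 1) ^ (k choose 2) * (4 * int n + 4)"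
proof -
  let ?f = "bordered k (border_weight k k n)"
  have "fdet (2 + (k - 1)) ?f = (- 1) ^ (2 * (k - 1)) *
      (fdet 2 (\<lambda>i j. ?f i (k - 1 + j)) * fdet (k - 1) (\<lambda>i j. ?f (2 + i) j))"
    by (rule fdet_block_antidiagonal) (auto simp: bordered_def fold_coeff_def)
  also have "fdet 2 (\<lambda>i j. ?f i (k - 1 + j)) = (- 1) ^ (k - 1) * (2 * (int n + 1))"
    using assms by (cases k) (auto simp: fdet_2 bordered_def fold_coeff_def border_weight_def algebra_simps)
  also have "fdet (k - 1) (\<lambda>i j. ?f (2 + i) j) = (- 1) ^ ((k - 1) choose 2) *
      (\<Prod>i<k - 1. ?f (2 + i) (k - 1 - 1 - i))"
    by (rule fdet_antitriangular) (auto simp: bordered_def fold_coeff_def)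
  also have "(\<Prod>i<k - 1. ?f (2 + i) (k - 1 - 1 - i)) = (\<Prod>i<k - 1. if i = k - 2 then 2 else 1)"
    by (rule prod.cong) (auto simp: bordered_def fold_coeff_def)
  also have "\<dots> = 2"
    using assms by simp
  finally have "fdet (2 + (k - 1)) ?f = (- 1) ^ ((k - 1) + ((k - 1) choose 2)) * (4 * int n + 4)"
    by (simp add: power_add)
  moreover have "(k - 1) + ((k - 1) choose 2) = k choose 2"
    using assms by (cases k) (auto simp: numeral_2_eq_2)
  ultimately show ?thesis
    using assms by simp
qed

text \<open>
  The last \<open>k - 1\<close> rows are diagonal on the first \<open>k - 1\<close> columns and vanish elsewhere. The rows
  above them are, on the remaining columns, upper triangular apart from the same \<open>2 \<times> 2\<close> block
  of the border and the fold row \<open>0\<close> as in the case \<open>r = k\<close>.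
\<close>

lemma fdet_bordered_remainder_2k_minus_2:
  assumes "k \<ge> 2"
  shows "fdet (2 * k - 2 + 1) (bordered k (border_weight k (2 * k - 2) n)) =
         (- 1) ^ (k - 1) * (4 * int n + 4)"
proof -
  let ?f = "bordered k (border_weight k (2 * k - 2) n)"
  let ?g = "\<lambda>i j. ?f i (k - 1 + j)"
  have "fdet (k + (k - 1)) ?f = (- 1) ^ (k * (k - 1)) *
      (fdet k ?g * fdet (k - 1) (\<lambda>i j. ?f (k + i) j))"
    by (rule fdet_block_antidiagonal) (use assms in \<open>auto simp: bordered_def fold_coeff_def\<close>)
  also have "fdet (k - 1) (\<lambda>i j. ?f (k + i) j) = fdet (k - 1) (\<lambda>i j. if i = j then if i = 0 then 2 else 1 else 0)"
    by (rule fdet_cong) (use assms in \<open>auto simp: bordered_def fold_coeff_def\<close>)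
  also have "\<dots> = (\<Prod>i<k - 1. if i = 0 then 2 else 1)"
    by (subst fdet_upper_triangular) auto
  also have "\<dots> = 2"
    using assms by simp
  also have "fdet k ?g = fdet (2 + (k - 2)) ?g"
    by (rule arg_cong[where f = "\<lambda>n. fdet n ?g"]) (use assms in simp)
  also have "fdet (2 + (k - 2)) ?g = fdet 2 ?g * fdet (k - 2) (\<lambda>i j. ?g (2 + i) (2 + j))"
    by (rule fdet_block_upper) (use assms in \<open>auto simp: bordered_def fold_coeff_def\<close>)
  also have "fdet (k - 2) (\<lambda>i j. ?g (2 + i) (2 + j)) = fdet (k - 2) (\<lambda>i j. of_bool (i = j))"
    by (rule fdet_cong) (use assms in \<open>auto simp: bordered_def fold_coeff_def\<close>)
  also have "fdet 2 ?g = (- 1) ^ (k - 1) * (2 * (int n + 1))"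
    using assms by (cases k) (auto simp: fdet_2 bordered_def fold_coeff_def border_weight_def algebra_simps)
  also have "(- 1 :: int) ^ (k * (k - 1)) = 1"
    by (rule neg_one_even_power) (cases k; simp)
  finally have "fdet (k + (k - 1)) ?f = (- 1) ^ (k - 1) * (4 * int n + 4)"
    by (simp add: fdet_upper_triangular)
  moreover have "k + (k - 1) = 2 * k - 2 + 1"
    using assms by simp
  ultimately show ?thesis
    by metis
qed

text \<open>
  For \<open>r < k - 1\<close> the fold row \<open>0\<close> vanishes, as its entries lie in the columns \<open>k - 1\<close> and \<open>k\<close>. For
  \<open>k < r < 2k - 2\<close> the fold rows \<open>k - 2\<close> and \<open>k\<close> both reduce to the entry \<open>1\<close> at column \<open>1\<close>.
\<close>

lemma fdet_bordered_remainder_other: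
  assumes "0 < r" "r < 2 * k - 2" "r \<noteq> k - 1" "r \<noteq> k"
  shows "fdet (r + 1) (bordered k v) = 0"
proof (cases "r < k")
  case True
  let ?A = "mat (r + 1) (r + 1) (\<lambda>(i, j). bordered k v i j)"
  have "det ?A = (\<Sum>j<r + 1. ?A $$ (1, j) * cofactor ?A 1 j)"
    by (rule laplace_expansion_row) (use assms in auto)
  also have "\<dots> = 0"
    by (rule sum.neutral) (use True assms in \<open>auto simp: bordered_def fold_coeff_def\<close>)
  finally show ?thesis
    by (simp add: fdet_def)
next
  case False
  show ?thesis
    unfolding fdet_def
    by (rule det_identical_rows[of _ _ "k - 1" "k + 1"])
       (use False assms in \<open>auto simp: bordered_def fold_coeff_def intro!: eq_vecI\<close>)
qed

theorem theorem1p11: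
  shows "(\<forall>k n r N :: nat. k \<ge> 2 \<longrightarrow> r \<le> 2 * k - 2 \<longrightarrow> N = (2 * k - 1) * n + r \<longrightarrow>
            det (mat N N (\<lambda>(i, j). int ((2 * i + 2 * j + 3) choose (i + j + k + 1)))) =
              (if r = 0 then 2 * int n + 1
               else if r = k - 1 then (- 1) ^ ((k - 1) choose 2) * (2 * int n + 1)
               else if r = k then (- 1) ^ (k choose 2) * (4 * int n + 4)
               else if r = 2 * k - 2 then (- 1) ^ (k - 1) * (4 * int n + 4)
               else 0))
       \<and> (\<forall>n :: nat.
            det (mat n n (\<lambda>(i, j). int ((2 * i + 2 * j + 3) choose (i + j + 2)))) = 2 * int n + 1)"
proof (intro conjI allI impI)
  fix k n r N :: nat
  assume k: "k \<ge> 2" and r: "r \<le> 2 * k - 2" and N: "N = (2 * k - 1) * n + r"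
  have "det (mat N N (\<lambda>(i, j). int ((2 * i + 2 * j + 3) choose (i + j + k + 1)))) =
      fdet (r + 1) (bordered k (border_weight k r n))"
    unfolding N fdet_def[symmetric] by (rule fdet_hankel_reduce) (use k in simp)
  also have "\<dots> = (if r = 0 then 2 * int n + 1
               else if r = k - 1 then (- 1) ^ ((k - 1) choose 2) * (2 * int n + 1)
               else if r = k then (- 1) ^ (k choose 2) * (4 * int n + 4)
               else if r = 2 * k - 2 then (- 1) ^ (k - 1) * (4 * int n + 4)
               else 0)"
  proof -
    consider "r = 0" | "r = k - 1" | "r = k" | "r = 2 * k - 2"
      | "0 < r" "r < 2 * k - 2" "r \<noteq> k - 1" "r \<noteq> k"
      using r by linarith
    thus ?thesis
    proof cases
      case 1
      thus ?thesis using fdet_bordered_remainder_0[of k n] k by simp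
    next
      case 2
      have "r \<noteq> 0" using 2 k by simp
      thus ?thesis using fdet_bordered_remainder_k_minus_1[OF k, of n] 2 by presburger
    next
      case 3
      have "r \<noteq> 0" "r \<noteq> k - 1" using 3 k by simp_all
      thus ?thesis using fdet_bordered_remainder_k[OF k, of n] 3 by presburger
    next
      case 4
      (* For k = 2 the remainders k and 2k - 2 coincide, and so do the two values. *)
      show ?thesis
      proof (cases "k = 2")
        case True
        thus ?thesis using fdet_bordered_remainder_k[OF k, of n] 4 by simp
      next
        case False
        hence "r \<noteq> 0" "r \<noteq> k - 1" "r \<noteq> k" using 4 k by simp_all
        thus ?thesis using fdet_bordered_remainder_2k_minus_2[OF k, of n] 4 by presburger
      qed
    next
      case 5
      thus ?thesis using fdet_bordered_remainder_other[OF 5, of "border_weight k r n"] by simp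
    qed
  qed
  finally show "det (mat N N (\<lambda>(i, j). int ((2 * i + 2 * j + 3) choose (i + j + k + 1)))) =
      (if r = 0 then 2 * int n + 1
               else if r = k - 1 then (- 1) ^ ((k - 1) choose 2) * (2 * int n + 1)
               else if r = k then (- 1) ^ (k choose 2) * (4 * int n + 4)
               else if r = 2 * k - 2 then (- 1) ^ (k - 1) * (4 * int n + 4)
               else 0)" .
next
  fix n :: nat
  show "det (mat n n (\<lambda>(i, j). int ((2 * i + 2 * j + 3) choose (i + j + 2)))) = 2 * int n + 1"
    using fdet_hankel_reduce[of 1 n 0] fdet_bordered_remainder_0[of 1 n] by (simp add: fdet_def)
qed

end
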